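(* Let $X$ be a synchronized system, let $Y$ be a shift space, and let $\phi:X\to Y$ be a semi-open code. Then $\phi$ is bi-continuing a.e.
   Context: Shift spaces are closed shift-invariant subsets of full shifts over finite alphabets; $\mathcal B(X)$ is the language of $X$. A code is a sliding block code (continuous shift-commuting map). $X$ is irreducible if for all $u,v\in\mathcal B(X)$ there is $w$ with $uwv\in\mathcal B(X)$. A word $v\in\mathcal B(X)$ is synchronizing if $uv,vw\in\mathcal B(X)$ implies $uvw\in\mathcal B(X)$; a synchronized system is an irreducible shift space with a synchronizing word. A map is semi-open if the image of every non-empty open set has non-empty interior (in the codomain). A point $x\in X$ is left transitive (resp. right transitive) if every block occurring in $X$ appears in $x$ infinitely often to the left (resp. to the right). Two points are left asymptotic (resp. right asymptotic) if their coordinates agree on some $(-\infty,N]$ (resp. $[N,\infty)$). A code $\phi:X\to Y$ is right-continuing a.e. if whenever $x\in X$ is left transitive and $\phi(x)$ is left asymptotic to a point $y\in Y$, there is $\overline x\in X$ left asymptotic to $x$ with $\phi(\overline x)=y$; left-continuing a.e. is defined symmetrically (with $x$ right transitive and right asymptoticity). Bi-continuing a.e. means both left- and right-continuing a.e. *)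

theory Defs
  imports "HOL-Analysis.Analysis"
begin

definition full_shift :: "'a set \<Rightarrow> (int \<Rightarrow> 'a) topology" where
  "full_shift A = product_topology (\<lambda>_. discrete_topology A) UNIV"

definition shift_map :: "(int \<Rightarrow> 'a) \<Rightarrow> int \<Rightarrow> 'a" where
  "shift_map x = (\<lambda>i. x (i + 1))"

definition shift_space :: "'a set \<Rightarrow> (int \<Rightarrow> 'a) set \<Rightarrow> bool" where
  "shift_space A X \<longleftrightarrow> finite A \<and> closedin (full_shift A) X \<and> shift_map ` X = X"

abbreviation shift_top :: "'a set \<Rightarrow> (int \<Rightarrow> 'a) set \<Rightarrow> (int \<Rightarrow> 'a) topology" where
  "shift_top A X \<equiv> subtopology (full_shift A) X"

text \<open>The word \<open>x\<^sub>i x\<^sub>i\<^sub>+\<^sub>1 \<dots> x\<^sub>i\<^sub>+\<^sub>n\<^sub>-\<^sub>1\<close>.\<close>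

definition block :: "(int \<Rightarrow> 'a) \<Rightarrow> int \<Rightarrow> nat \<Rightarrow> 'a list" where
  "block x i n = map (\<lambda>k. x (i + int k)) [0..<n]"

text \<open>The empty word belongs to the language of every nonempty shift space.\<close>

definition language :: "(int \<Rightarrow> 'a) set \<Rightarrow> 'a list set" where
  "language X = {block x i n | x i n. x \<in> X}"

definition irreducible_shift :: "(int \<Rightarrow> 'a) set \<Rightarrow> bool" where
  "irreducible_shift X \<longleftrightarrow>
     (\<forall>u \<in> language X. \<forall>v \<in> language X. \<exists>w. u @ w @ v \<in> language X)"

definition synchronizing_word :: "(int \<Rightarrow> 'a) set \<Rightarrow> 'a list \<Rightarrow> bool" where
  "synchronizing_word X v \<longleftrightarrow> v \<in> language X \<and>
     (\<forall>u w. u @ v \<in> language X \<and> v @ w \<in> language X \<longrightarrow> u @ v @ w \<in> language X)"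

definition synchronized_system :: "'a set \<Rightarrow> (int \<Rightarrow> 'a) set \<Rightarrow> bool" where
  "synchronized_system A X \<longleftrightarrow>
     shift_space A X \<and> irreducible_shift X \<and> (\<exists>v. synchronizing_word X v)"

definition sliding_block_code ::
  "'a set \<Rightarrow> (int \<Rightarrow> 'a) set \<Rightarrow> 'b set \<Rightarrow> (int \<Rightarrow> 'b) set \<Rightarrow> ((int \<Rightarrow> 'a) \<Rightarrow> int \<Rightarrow> 'b) \<Rightarrow> bool" where
  "sliding_block_code A X B Y \<phi> \<longleftrightarrow>
     continuous_map (shift_top A X) (shift_top B Y) \<phi> \<and>
     (\<forall>x \<in> X. \<phi> (shift_map x) = shift_map (\<phi> x))"

definition semi_open_map :: "'c topology \<Rightarrow> 'd topology \<Rightarrow> ('c \<Rightarrow> 'd) \<Rightarrow> bool" where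
  "semi_open_map S T f \<longleftrightarrow>
     (\<forall>U. openin S U \<and> U \<noteq> {} \<longrightarrow> T interior_of (f ` U) \<noteq> {})"

definition left_transitive :: "(int \<Rightarrow> 'a) set \<Rightarrow> (int \<Rightarrow> 'a) \<Rightarrow> bool" where
  "left_transitive X x \<longleftrightarrow> x \<in> X \<and>
     (\<forall>w \<in> language X. infinite {i. i < 0 \<and> block x i (length w) = w})"

definition right_transitive :: "(int \<Rightarrow> 'a) set \<Rightarrow> (int \<Rightarrow> 'a) \<Rightarrow> bool" where
  "right_transitive X x \<longleftrightarrow> x \<in> X \<and>
     (\<forall>w \<in> language X. infinite {i. i > 0 \<and> block x i (length w) = w})"

definition left_asymptotic :: "(int \<Rightarrow> 'a) \<Rightarrow> (int \<Rightarrow> 'a) \<Rightarrow> bool" where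
  "left_asymptotic x y \<longleftrightarrow> (\<exists>N. \<forall>i \<le> N. x i = y i)"

definition right_asymptotic :: "(int \<Rightarrow> 'a) \<Rightarrow> (int \<Rightarrow> 'a) \<Rightarrow> bool" where
  "right_asymptotic x y \<longleftrightarrow> (\<exists>N. \<forall>i \<ge> N. x i = y i)"

definition right_continuing_ae ::
  "(int \<Rightarrow> 'a) set \<Rightarrow> (int \<Rightarrow> 'b) set \<Rightarrow> ((int \<Rightarrow> 'a) \<Rightarrow> int \<Rightarrow> 'b) \<Rightarrow> bool" where
  "right_continuing_ae X Y \<phi> \<longleftrightarrow>
     (\<forall>x \<in> X. \<forall>y \<in> Y. left_transitive X x \<and> left_asymptotic (\<phi> x) y \<longrightarrow>
        (\<exists>x' \<in> X. left_asymptotic x' x \<and> \<phi> x' = y))"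

definition left_continuing_ae ::
  "(int \<Rightarrow> 'a) set \<Rightarrow> (int \<Rightarrow> 'b) set \<Rightarrow> ((int \<Rightarrow> 'a) \<Rightarrow> int \<Rightarrow> 'b) \<Rightarrow> bool" where
  "left_continuing_ae X Y \<phi> \<longleftrightarrow>
     (\<forall>x \<in> X. \<forall>y \<in> Y. right_transitive X x \<and> right_asymptotic (\<phi> x) y \<longrightarrow>
        (\<exists>x' \<in> X. right_asymptotic x' x \<and> \<phi> x' = y))"

definition bi_continuing_ae ::
  "(int \<Rightarrow> 'a) set \<Rightarrow> (int \<Rightarrow> 'b) set \<Rightarrow> ((int \<Rightarrow> 'a) \<Rightarrow> int \<Rightarrow> 'b) \<Rightarrow> bool" where
  "bi_continuing_ae X Y \<phi> \<longleftrightarrow> right_continuing_ae X Y \<phi> \<and> left_continuing_ae X Y \<phi>"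

end

theory Submission
  imports Defs
begin

text \<open>
  Since \<open>X\<close> is compact, \<open>\<phi> x i\<close> depends only on the coordinates of \<open>x\<close> at distance at most
  \<open>m\<close> from \<open>i\<close>, for a fixed window radius \<open>m\<close> (\<open>window_radius_exists\<close>). Every word of the
  language that contains a synchronizing word is synchronizing, so there is a synchronizing word
  \<open>s\<close> of length at least \<open>2 * m\<close> (\<open>long_synchronizing_word_exists\<close>).

  The points of \<open>X\<close> that carry \<open>s\<close> at position \<open>0\<close> form a non-empty open set \<open>U\<close>, so \<open>\<phi> ` U\<close>
  contains a non-empty cylinder of \<open>Y\<close>. Taking a long block \<open>a\<close> of a point of \<open>U\<close> whose image lies
  in this cylinder yields the key property (\<open>marker_word_exists\<close>): wherever \<open>a\<close> occurs in a
  point \<open>x\<close> of \<open>X\<close>, and \<open>y\<close> is a point of \<open>Y\<close> that agrees with \<open>\<phi> x\<close> along this occurrence,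
  \<open>y\<close> has a preimage \<open>z\<close> in \<open>X\<close> that carries \<open>s\<close> at the same place as \<open>x\<close> does.

  If \<open>x\<close> is left transitive and \<open>\<phi> x\<close> is left asymptotic to \<open>y\<close>, then \<open>a\<close> occurs in \<open>x\<close> inside
  the region where \<open>\<phi> x\<close> and \<open>y\<close> agree. Following \<open>x\<close> up to the end of the common occurrence of
  \<open>s\<close> and \<open>z\<close> from there on gives a point of \<open>X\<close>, because \<open>s\<close> is synchronizing
  (\<open>splice_mem\<close>). Each window of radius \<open>m\<close> lies in the part where this point agrees with \<open>x\<close>
  or in the part where it agrees with \<open>z\<close>, because these parts overlap in \<open>s\<close>. In either case the
  image symbol is that of \<open>y\<close> (\<open>splice_image\<close>). Exchanging the roles of \<open>x\<close> and \<open>z\<close> gives the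
  statement on the other side.
\<close>

section \<open>The topology of the full shift\<close>

lemma topspace_full_shift: "topspace (full_shift A) = {x. range x \<subseteq> A}"
  by (auto simp: full_shift_def PiE_def extensional_def Pi_def)

text \<open>
  The points that agree with \<open>x\<close> at all coordinates of absolute value at most \<open>M\<close>. No alphabet is
  imposed, so these sets have to be intersected with the space under consideration.
\<close>

definition central_cylinder :: "nat \<Rightarrow> (int \<Rightarrow> 'a) \<Rightarrow> (int \<Rightarrow> 'a) set" where
  "central_cylinder M x = {x'. \<forall>j. \<bar>j\<bar> \<le> int M \<longrightarrow> x' j = x j}"

lemma central_cylinderI: "(\<And>j. \<bar>j\<bar> \<le> int M \<Longrightarrow> x' j = x j) \<Longrightarrow> x' \<in> central_cylinder M x"
  by (simp add: central_cylinder_def)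

lemma central_cylinderD: "x' \<in> central_cylinder M x \<Longrightarrow> \<bar>j\<bar> \<le> int M \<Longrightarrow> x' j = x j"
  by (simp add: central_cylinder_def)

lemma central_cylinder_eq: "x' \<in> central_cylinder M x \<Longrightarrow> central_cylinder M x' = central_cylinder M x"
  by (auto simp: central_cylinder_def)

lemma central_cylinder_antimono: "M \<le> N \<Longrightarrow> central_cylinder N x \<subseteq> central_cylinder M x"
  by (auto simp: central_cylinder_def)

lemma self_mem_central_cylinder [simp]: "x \<in> central_cylinder M x"
  by (simp add: central_cylinder_def)

lemma openin_full_shift_iff:
  "openin (full_shift A) S \<longleftrightarrow>
     S \<subseteq> topspace (full_shift A) \<and>
     (\<forall>x\<in>S. \<exists>M. topspace (full_shift A) \<inter> central_cylinder M x \<subseteq> S)"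
  (is "?L \<longleftrightarrow> ?R")
proof
  assume L: ?L
  have "\<exists>M. topspace (full_shift A) \<inter> central_cylinder M x \<subseteq> S" if "x \<in> S" for x
  proof -
    from L that obtain U where fin: "finite {i. U i \<noteq> A}"
      and xU: "x \<in> PiE UNIV U" and sub: "PiE UNIV U \<subseteq> S"
      unfolding full_shift_def openin_product_topology_alt by force
    obtain M where M: "\<And>i. U i \<noteq> A \<Longrightarrow> nat \<bar>i\<bar> \<le> M"
      using finite_nat_set_iff_bounded_le[of "(\<lambda>i. nat \<bar>i\<bar>) ` {i. U i \<noteq> A}"] fin by auto
    have "x' \<in> S" if x': "range x' \<subseteq> A" "x' \<in> central_cylinder M x" for x'
    proof -
      have "x' i \<in> U i" for i
      proof (cases "U i = A")
        case False
        then have "\<bar>i\<bar> \<le> int M" using M[of i] by linarith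
        then have "x' i = x i" using x'(2) central_cylinderD by blast
        then show ?thesis using xU by auto
      qed (use x'(1) in auto)
      then show ?thesis using sub by auto
    qed
    then show ?thesis unfolding topspace_full_shift by blast
  qed
  then show ?R using openin_subset[OF L] by blast
next
  assume R: ?R
  have "\<exists>U. finite {i \<in> UNIV. U i \<noteq> topspace (discrete_topology A)} \<and>
          (\<forall>i\<in>UNIV. openin (discrete_topology A) (U i)) \<and> x \<in> PiE UNIV U \<and> PiE UNIV U \<subseteq> S"
    if "x \<in> S" for x
  proof -
    from R that have xA: "range x \<subseteq> A" unfolding topspace_full_shift by blast
    from R that obtain M where M: "topspace (full_shift A) \<inter> central_cylinder M x \<subseteq> S" by blast
    define U where "U = (\<lambda>i::int. if \<bar>i\<bar> \<le> int M then {x i} else A)"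
    have "{i. U i \<noteq> A} \<subseteq> {- int M..int M}" by (auto simp: U_def split: if_splits)
    then have "finite {i. U i \<noteq> A}" by (rule finite_subset) simp
    moreover have UA: "U i \<subseteq> A" for i using xA by (auto simp: U_def)
    moreover have "x \<in> PiE UNIV U" using xA by (auto simp: U_def)
    moreover have "PiE UNIV U \<subseteq> S"
    proof
      fix x' assume "x' \<in> PiE UNIV U"
      then have x': "x' j \<in> U j" for j by auto
      have "range x' \<subseteq> A" using x' UA by blast
      moreover have "x' \<in> central_cylinder M x"
      proof (rule central_cylinderI)
        show "x' j = x j" if "\<bar>j\<bar> \<le> int M" for j using x'[of j] that by (simp add: U_def)
      qed
      ultimately show "x' \<in> S" using M unfolding topspace_full_shift by blast
    qed
    ultimately show ?thesis by (intro exI[of _ U]) simp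
  qed
  then show ?L unfolding full_shift_def openin_product_topology_alt by blast
qed

lemma shift_space_subset_topspace: "shift_space A X \<Longrightarrow> X \<subseteq> topspace (full_shift A)"
  unfolding shift_space_def by (simp add: closedin_subset)

lemma topspace_shift_top: "shift_space A X \<Longrightarrow> topspace (shift_top A X) = X"
  using shift_space_subset_topspace by (metis topspace_subtopology_subset)

lemma openin_shift_top_iff:
  assumes X: "shift_space A X"
  shows "openin (shift_top A X) S \<longleftrightarrow>
     S \<subseteq> X \<and> (\<forall>x\<in>S. \<exists>M. X \<inter> central_cylinder M x \<subseteq> S)"
  (is "?L \<longleftrightarrow> ?R")
proof
  assume ?L
  then obtain T where "openin (full_shift A) T" and S: "S = T \<inter> X"
    unfolding openin_subtopology by blast
  then have "\<exists>M. topspace (full_shift A) \<inter> central_cylinder M x \<subseteq> T" if "x \<in> T" for x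
    using that unfolding openin_full_shift_iff by blast
  then show ?R
    using shift_space_subset_topspace[OF X] unfolding S by blast
next
  assume R: ?R
  define T where "T = {x \<in> topspace (full_shift A). \<exists>M. X \<inter> central_cylinder M x \<subseteq> S}"
  have "\<exists>M. topspace (full_shift A) \<inter> central_cylinder M x \<subseteq> T" if "x \<in> T" for x
  proof -
    from that obtain M where M: "X \<inter> central_cylinder M x \<subseteq> S" by (auto simp: T_def)
    then have "topspace (full_shift A) \<inter> central_cylinder M x \<subseteq> T"
      unfolding T_def using central_cylinder_eq by blast
    then show ?thesis ..
  qed
  moreover have "T \<subseteq> topspace (full_shift A)" by (auto simp: T_def)
  ultimately have "openin (full_shift A) T" unfolding openin_full_shift_iff by blast
  moreover have "S = T \<inter> X"
  proof
    show "S \<subseteq> T \<inter> X"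
      using R shift_space_subset_topspace[OF X] unfolding T_def by blast
    show "T \<inter> X \<subseteq> S"
      unfolding T_def using self_mem_central_cylinder by blast
  qed
  ultimately show ?L unfolding openin_subtopology by blast
qed

lemma mem_shift_space_if_approximated:
  assumes X: "shift_space A X" and x: "x \<in> topspace (full_shift A)"
    and approx: "\<And>M. X \<inter> central_cylinder M x \<noteq> {}"
  shows "x \<in> X"
proof (rule ccontr)
  assume "x \<notin> X"
  moreover have "openin (full_shift A) (topspace (full_shift A) - X)"
    using X unfolding shift_space_def by blast
  ultimately obtain M where
    "topspace (full_shift A) \<inter> central_cylinder M x \<subseteq> topspace (full_shift A) - X"
    unfolding openin_full_shift_iff using x by blast
  then show False using approx[of M] shift_space_subset_topspace[OF X] by blast
qed

lemma compact_space_shift_top: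
  assumes "shift_space A X"
  shows "compact_space (shift_top A X)"
proof -
  have "compact_space (full_shift A)"
    using assms unfolding full_shift_def shift_space_def
    by (simp add: compact_space_product_topology compact_space_discrete_topology)
  then show ?thesis
    using assms unfolding shift_space_def
    by (simp add: closedin_compact_space compact_space_subtopology)
qed

section \<open>Translations and windows\<close>

lemma translate_mem:
  assumes X: "shift_space A X" and "x \<in> X"
  shows "(\<lambda>i. x (i + k)) \<in> X"
proof (induction k rule: int_induct[where k = 0])
  case base
  then show ?case using \<open>x \<in> X\<close> by simp
next
  case (step1 k)
  then have "shift_map (\<lambda>i. x (i + k)) \<in> X" using X unfolding shift_space_def by blast
  then show ?case by (simp add: shift_map_def algebra_simps)
next
  case (step2 k)
  then obtain u where "u \<in> X" and u: "(\<lambda>i. x (i + k)) = shift_map u"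
    using X unfolding shift_space_def by blast
  have "(\<lambda>i. x (i + (k - 1))) = u"
  proof
    fix i
    show "x (i + (k - 1)) = u i"
      using fun_cong[OF u, of "i - 1"] by (simp add: shift_map_def algebra_simps)
  qed
  then show ?case using \<open>u \<in> X\<close> by simp
qed

lemma code_translate:
  assumes X: "shift_space A X" and \<phi>: "sliding_block_code A X B Y \<phi>" and "x \<in> X"
  shows "\<phi> (\<lambda>i. x (i + k)) = (\<lambda>i. \<phi> x (i + k))"
proof -
  have shift: "\<phi> (\<lambda>i. x (i + (k + 1))) = shift_map (\<phi> (\<lambda>i. x (i + k)))" for k
  proof -
    have "\<phi> (shift_map (\<lambda>i. x (i + k))) = shift_map (\<phi> (\<lambda>i. x (i + k)))"
      using \<phi> translate_mem[OF X \<open>x \<in> X\<close>] unfolding sliding_block_code_def by blast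
    moreover have "shift_map (\<lambda>i. x (i + k)) = (\<lambda>i. x (i + (k + 1)))"
      by (simp add: shift_map_def algebra_simps)
    ultimately show ?thesis by simp
  qed
  show ?thesis
  proof (induction k rule: int_induct[where k = 0])
    case base
    show ?case by simp
  next
    case (step1 k)
    then show ?case using shift[of k] by (simp add: shift_map_def algebra_simps)
  next
    case (step2 k)
    show ?case
    proof
      fix i
      show "\<phi> (\<lambda>i. x (i + (k - 1))) i = \<phi> x (i + (k - 1))"
        using shift[of "k - 1"] fun_cong[OF step2(2), of "i - 1"]
        by (simp add: shift_map_def algebra_simps)
    qed
  qed
qed

lemma code_mem:
  assumes X: "shift_space A X" and Y: "shift_space B Y"
    and \<phi>: "sliding_block_code A X B Y \<phi>" and "x \<in> X"
  shows "\<phi> x \<in> Y"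
proof -
  have "\<phi> ` topspace (shift_top A X) \<subseteq> topspace (shift_top B Y)"
    using \<phi> unfolding sliding_block_code_def by (meson continuous_map_image_subset_topspace)
  then show ?thesis
    using \<open>x \<in> X\<close> unfolding topspace_shift_top[OF X] topspace_shift_top[OF Y] by blast
qed

text \<open>The image under \<open>\<phi>\<close> at \<open>i\<close> depends only on the coordinates from \<open>i - m\<close> to \<open>i + m\<close>.\<close>

definition window_radius ::
  "(int \<Rightarrow> 'a) set \<Rightarrow> ((int \<Rightarrow> 'a) \<Rightarrow> int \<Rightarrow> 'b) \<Rightarrow> nat \<Rightarrow> bool" where
  "window_radius X \<phi> m \<longleftrightarrow>
     (\<forall>x\<in>X. \<forall>x'\<in>X. \<forall>i. (\<forall>j. \<bar>j - i\<bar> \<le> int m \<longrightarrow> x' j = x j) \<longrightarrow> \<phi> x' i = \<phi> x i)"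

lemma window_radiusD:
  assumes "window_radius X \<phi> m" "x \<in> X" "x' \<in> X"
    and "\<And>j. \<bar>j - i\<bar> \<le> int m \<Longrightarrow> x' j = x j"
  shows "\<phi> x' i = \<phi> x i"
  using assms unfolding window_radius_def by blast

text \<open>
  The non-trivial half of the Curtis--Hedlund--Lyndon theorem, in the form needed here.
\<close>

lemma window_radius_exists:
  assumes X: "shift_space A X" and Y: "shift_space B Y"
    and \<phi>: "sliding_block_code A X B Y \<phi>"
  obtains m where "window_radius X \<phi> m"
proof -
  \<comment> \<open>\<open>V m\<close> is the set of points at which radius \<open>m\<close> suffices for coordinate \<open>0\<close>. These sets form
    an increasing open cover of the compact space \<open>X\<close>, so one of them is all of \<open>X\<close>.\<close>
  define V where "V m = {x \<in> X. \<forall>x' \<in> X \<inter> central_cylinder m x. \<phi> x' 0 = \<phi> x 0}" for m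
  have openV: "openin (shift_top A X) (V m)" for m
  proof -
    have "X \<inter> central_cylinder m x \<subseteq> V m" if "x \<in> V m" for x
      using that central_cylinder_eq unfolding V_def by (smt (verit) Int_iff mem_Collect_eq subsetI)
    moreover have "V m \<subseteq> X" by (auto simp: V_def)
    ultimately show ?thesis unfolding openin_shift_top_iff[OF X] by blast
  qed
  have monoV: "V m \<subseteq> V n" if "m \<le> n" for m n
    using central_cylinder_antimono[OF that] unfolding V_def by blast
  have cover: "X \<subseteq> \<Union> (range V)"
  proof
    fix x assume "x \<in> X"
    let ?W = "{y \<in> Y. y 0 = \<phi> x 0}"
    have "Y \<inter> central_cylinder 0 y \<subseteq> ?W" if "y \<in> ?W" for y
      using that central_cylinderD[of _ 0 y 0] by auto
    then have "openin (shift_top B Y) ?W"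
      unfolding openin_shift_top_iff[OF Y] by blast
    then have "openin (shift_top A X) {x' \<in> topspace (shift_top A X). \<phi> x' \<in> ?W}"
      using \<phi> unfolding sliding_block_code_def by (blast intro: openin_continuous_map_preimage)
    moreover have "x \<in> {x' \<in> topspace (shift_top A X). \<phi> x' \<in> ?W}"
      using \<open>x \<in> X\<close> code_mem[OF X Y \<phi> \<open>x \<in> X\<close>] unfolding topspace_shift_top[OF X] by simp
    ultimately obtain M where
      "X \<inter> central_cylinder M x \<subseteq> {x' \<in> topspace (shift_top A X). \<phi> x' \<in> ?W}"
      unfolding openin_shift_top_iff[OF X] by blast
    then have "x \<in> V M" using \<open>x \<in> X\<close> unfolding V_def by blast
    then show "x \<in> \<Union> (range V)" by blast
  qed
  have "compactin (shift_top A X) X"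
    using compact_space_shift_top[OF X] unfolding compact_space_def topspace_shift_top[OF X] .
  moreover have "\<And>U. U \<in> range V \<Longrightarrow> openin (shift_top A X) U" using openV by blast
  ultimately obtain \<F> where "finite \<F>" "\<F> \<subseteq> range V" "X \<subseteq> \<Union> \<F>"
    using compactinD cover by metis
  then obtain K where "finite K" and K: "X \<subseteq> (\<Union>m\<in>K. V m)"
    by (metis finite_subset_image)
  then obtain m where "\<forall>k\<in>K. k \<le> m" using finite_nat_set_iff_bounded_le by blast
  with K monoV have m: "X \<subseteq> V m" by blast
  have "\<phi> x' i = \<phi> x i"
    if x: "x \<in> X" "x' \<in> X" and eq: "\<And>j. \<bar>j - i\<bar> \<le> int m \<Longrightarrow> x' j = x j" for x x' i
  proof -
    define u u' where "u = (\<lambda>j. x (j + i))" and "u' = (\<lambda>j. x' (j + i))"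
    have "u \<in> V m" using m translate_mem[OF X x(1)] unfolding u_def by blast
    moreover have "u' \<in> X" unfolding u'_def by (rule translate_mem[OF X x(2)])
    moreover have "u' \<in> central_cylinder m u"
      unfolding u_def u'_def by (rule central_cylinderI) (simp add: eq)
    ultimately have "\<phi> u' 0 = \<phi> u 0" unfolding V_def by blast
    then show ?thesis
      unfolding u_def u'_def code_translate[OF X \<phi> x(1)] code_translate[OF X \<phi> x(2)] by simp
  qed
  then show thesis using that unfolding window_radius_def by blast
qed

section \<open>Blocks and synchronizing words\<close>

lemma length_block [simp]: "length (block x i n) = n"
  by (simp add: block_def)

lemma nth_block [simp]: "k < n \<Longrightarrow> block x i n ! k = x (i + int k)"
  by (simp add: block_def)

lemma block_eq_block_iff:
  "block x i n = block x' i' n \<longleftrightarrow> (\<forall>j. 0 \<le> j \<and> j < int n \<longrightarrow> x (i + j) = x' (i' + j))"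
proof -
  have "block x i n = block x' i' n \<longleftrightarrow> (\<forall>k<n. x (i + int k) = x' (i' + int k))"
    by (auto simp: list_eq_iff_nth_eq)
  also have "\<dots> \<longleftrightarrow> (\<forall>j. 0 \<le> j \<and> j < int n \<longrightarrow> x (i + j) = x' (i' + j))"
    by (metis nat_0_le nat_less_iff of_nat_0_le_iff of_nat_less_iff)
  finally show ?thesis .
qed

lemma block_add: "block x i (m + n) = block x i m @ block x (i + int m) n"
  by (auto simp: list_eq_iff_nth_eq nth_append)

lemma block_mem_language [intro]: "x \<in> X \<Longrightarrow> block x i n \<in> language X"
  unfolding language_def by blast

text \<open>By shift invariance a word of the language can be found at any prescribed position.\<close>

lemma language_obtain:
  assumes X: "shift_space A X" and w: "w \<in> language X"
  obtains x where "x \<in> X" "block x p (length w) = w"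
proof -
  from w obtain x i n where x: "x \<in> X" "w = block x i n" unfolding language_def by blast
  have "block (\<lambda>j. x (j + (i - p))) p (length w) = w"
    using x(2) by (simp add: block_eq_block_iff algebra_simps)
  then show thesis using that translate_mem[OF X x(1)] by blast
qed

lemma language_appendD:
  assumes "u @ w \<in> language X"
  shows "u \<in> language X" "w \<in> language X"
proof -
  from assms obtain x i n where x: "x \<in> X" and uw: "u @ w = block x i n"
    unfolding language_def by blast
  then have "n = length u + length w" by (metis length_append length_block)
  with uw have "u @ w = block x i (length u) @ block x (i + int (length u)) (length w)"
    by (simp add: block_add)
  then have "u = block x i (length u)" "w = block x (i + int (length u)) (length w)"
    by (simp_all add: append_eq_append_conv)
  then show "u \<in> language X" "w \<in> language X" using x by (metis block_mem_language)+
qed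

lemma synchronizing_word_extend:
  assumes v: "synchronizing_word X v" and "p @ v @ q \<in> language X"
  shows "synchronizing_word X (p @ v @ q)"
  unfolding synchronizing_word_def
proof (intro conjI allI impI)
  fix u w assume "u @ (p @ v @ q) \<in> language X \<and> (p @ v @ q) @ w \<in> language X"
  then have "(u @ p) @ v \<in> language X" "v @ (q @ w) \<in> language X"
    using language_appendD[of "(u @ p) @ v" q X] language_appendD[of p "v @ q @ w" X] by auto
  then have "(u @ p) @ v @ (q @ w) \<in> language X"
    using v unfolding synchronizing_word_def by blast
  then show "u @ (p @ v @ q) @ w \<in> language X" by simp
qed (fact assms(2))

lemma long_synchronizing_word_exists:
  assumes X: "shift_space A X" and v: "synchronizing_word X v"
  obtains s where "synchronizing_word X s" "n \<le> length s"
proof -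
  have "v \<in> language X" using v unfolding synchronizing_word_def by blast
  with X obtain x where x: "x \<in> X" "block x 0 (length v) = v" by (rule language_obtain)
  let ?s = "block x 0 (length v + n)"
  have "?s = [] @ v @ block x (int (length v)) n" using x(2) by (simp add: block_add)
  with synchronizing_word_extend[OF v, of "[]"] have "synchronizing_word X ?s"
    using block_mem_language[OF x(1)] by metis
  then show thesis using that by simp
qed

lemma splice_mem:
  assumes X: "shift_space A X" and s: "synchronizing_word X s"
    and x: "x \<in> X" "block x i (length s) = s" and z: "z \<in> X" "block z i (length s) = s"
  shows "(\<lambda>j. if j < i + int (length s) then x j else z j) \<in> X" (is "?g \<in> X")
proof (rule mem_shift_space_if_approximated[OF X])
  have "x \<in> topspace (full_shift A)" "z \<in> topspace (full_shift A)"
    using shift_space_subset_topspace[OF X] x(1) z(1) by auto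
  then show "?g \<in> topspace (full_shift A)" unfolding topspace_full_shift by auto
next
  fix M :: nat
  let ?L = "length s"
  \<comment> \<open>\<open>Suc\<close> makes the right end of the block exceed \<open>M\<close> even if \<open>s\<close> is empty.\<close>
  define r where "r = Suc (M + nat \<bar>i\<bar>)"
  have left: "block x (i - int r) (r + ?L) = block x (i - int r) r @ s"
    and right: "block z i (?L + r) = s @ block z (i + int ?L) r"
    using x(2) z(2) by (simp_all add: block_add)
  have "block ?g i ?L = s"
    using x(2) block_eq_block_iff[of ?g i ?L x i] by simp
  moreover have "block ?g (i - int r) r = block x (i - int r) r"
    "block ?g (i + int ?L) r = block z (i + int ?L) r"
    unfolding block_eq_block_iff by simp_all
  ultimately have "block ?g (i - int r) (r + ?L + r)
      = block x (i - int r) r @ s @ block z (i + int ?L) r"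
    by (simp add: block_add)
  also have "\<dots> \<in> language X"
    using s left right block_mem_language[OF x(1)] block_mem_language[OF z(1)]
    unfolding synchronizing_word_def by metis
  finally obtain x' where x': "x' \<in> X"
    "block x' (i - int r) (r + ?L + r) = block ?g (i - int r) (r + ?L + r)"
    using language_obtain[OF X, of _ "i - int r"] length_block by metis
  have "x' j = ?g j" if "\<bar>j\<bar> \<le> int M" for j
  proof -
    have "0 \<le> j - (i - int r)" "j - (i - int r) < int (r + ?L + r)"
      using that by (simp_all add: r_def)
    with x'(2) have "x' (i - int r + (j - (i - int r))) = ?g (i - int r + (j - (i - int r)))"
      unfolding block_eq_block_iff by blast
    moreover have "i - int r + (j - (i - int r)) = j" by simp
    ultimately show ?thesis by metis
  qed
  then have "x' \<in> central_cylinder M ?g" by (rule central_cylinderI)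
  then show "X \<inter> central_cylinder M ?g \<noteq> {}" using x'(1) by blast
qed

text \<open>
  A window of radius \<open>m\<close> centred to the left of \<open>i + L - m\<close> ends before \<open>i + L\<close>, where the splice
  is \<open>x\<close>. One centred at or to the right of \<open>i + m\<close> starts at or after \<open>i\<close>, where the splice is \<open>z\<close>,
  since \<open>x\<close> and \<open>z\<close> coincide on the common word. As \<open>2 * m \<le> L\<close>, every window is of one of these
  two kinds.
\<close>

lemma splice_image:
  fixes x z :: "int \<Rightarrow> 'a" and m L :: nat
  defines "g \<equiv> \<lambda>i j. if j < i + int L then x j else z j"
  assumes window: "window_radius X \<phi> m"
    and L: "2 * m \<le> L"
    and x: "x \<in> X" and z: "z \<in> X" and g: "g i \<in> X"
    and common: "block x i L = block z i L"
    and yx: "\<And>k. k < i + int L - int m \<Longrightarrow> \<phi> x k = y k"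
    and yz: "\<And>k. i + int m \<le> k \<Longrightarrow> \<phi> z k = y k"
  shows "\<phi> (g i) = y"
proof
  fix k
  have eq: "x j = z j" if "i \<le> j" "j < i + int L" for j
    using common[unfolded block_eq_block_iff, rule_format, of "j - i"] that by simp
  show "\<phi> (g i) k = y k"
  proof (cases "k < i + int L - int m")
    case True
    have "\<phi> (g i) k = \<phi> x k"
      by (rule window_radiusD[OF window x g]) (use True in \<open>auto simp: g_def\<close>)
    then show ?thesis using yx True by simp
  next
    case False
    then have k: "i + int m \<le> k" using L by linarith
    have "\<phi> (g i) k = \<phi> z k"
      by (rule window_radiusD[OF window z g]) (use k eq in \<open>auto simp: g_def\<close>)
    then show ?thesis using yz k by simp
  qed
qed

section \<open>Semi-open codes\<close>

text \<open>
  The word \<open>a\<close> marks \<open>s\<close> at offset \<open>k\<close>: if \<open>a\<close> occurs in a point \<open>x\<close> of \<open>X\<close>, and \<open>y\<close> in \<open>Y\<close> agrees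
  with \<open>\<phi> x\<close> along this occurrence, then \<open>s\<close> occurs in \<open>x\<close> at offset \<open>k\<close> within it, and \<open>y\<close> has a
  preimage in \<open>X\<close> with \<open>s\<close> at the same place.
\<close>

definition marker_word ::
  "(int \<Rightarrow> 'a) set \<Rightarrow> (int \<Rightarrow> 'b) set \<Rightarrow> ((int \<Rightarrow> 'a) \<Rightarrow> int \<Rightarrow> 'b) \<Rightarrow> 'a list \<Rightarrow> 'a list \<Rightarrow> nat \<Rightarrow> bool"
  where
  "marker_word X Y \<phi> s a k \<longleftrightarrow> a \<in> language X \<and> k + length s \<le> length a \<and>
     (\<forall>x\<in>X. \<forall>y\<in>Y. \<forall>p. block x p (length a) = a \<and>
        block (\<phi> x) p (length a) = block y p (length a) \<longrightarrow>
        block x (p + int k) (length s) = s \<and>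
        (\<exists>z\<in>X. \<phi> z = y \<and> block z (p + int k) (length s) = s))"

lemma marker_wordE:
  assumes "marker_word X Y \<phi> s a k" "x \<in> X" "y \<in> Y" "block x p (length a) = a"
    and "block (\<phi> x) p (length a) = block y p (length a)"
  obtains z where "block x (p + int k) (length s) = s"
    "z \<in> X" "\<phi> z = y" "block z (p + int k) (length s) = s"
  using assms unfolding marker_word_def by blast

text \<open>
  Semi-openness enters only here: the image of the cylinder of \<open>s\<close> contains a cylinder of \<open>Y\<close>, and
  an occurrence of \<open>a\<close> in \<open>x\<close> forces \<open>\<phi> x\<close>, hence \<open>y\<close>, into a translate of the latter.
\<close>

lemma marker_word_exists:
  assumes X: "shift_space A X" and Y: "shift_space B Y"
    and \<phi>: "sliding_block_code A X B Y \<phi>"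
    and semi: "semi_open_map (shift_top A X) (shift_top B Y) \<phi>"
    and s: "s \<in> language X"
  obtains a k where "marker_word X Y \<phi> s a k"
proof -
  obtain m where window: "window_radius X \<phi> m"
    using window_radius_exists[OF X Y \<phi>] .
  define U where "U = {x \<in> X. block x 0 (length s) = s}"
  have "X \<inter> central_cylinder (length s) x \<subseteq> U" if "x \<in> U" for x
  proof
    fix x' assume x': "x' \<in> X \<inter> central_cylinder (length s) x"
    then have "block x' 0 (length s) = block x 0 (length s)"
      using central_cylinderD[of x' "length s" x] unfolding block_eq_block_iff by simp
    then show "x' \<in> U" using that x' by (simp add: U_def)
  qed
  moreover have "U \<subseteq> X" by (auto simp: U_def)
  ultimately have "openin (shift_top A X) U"
    unfolding openin_shift_top_iff[OF X] by blast
  moreover have "U \<noteq> {}" using language_obtain[OF X s, of 0] unfolding U_def by blast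
  ultimately have "shift_top B Y interior_of (\<phi> ` U) \<noteq> {}"
    using semi unfolding semi_open_map_def by blast
  then obtain y0 where y0: "y0 \<in> shift_top B Y interior_of (\<phi> ` U)" by blast
  have int_sub: "shift_top B Y interior_of (\<phi> ` U) \<subseteq> \<phi> ` U" by (rule interior_of_subset)
  with y0 have "y0 \<in> \<phi> ` U" by (rule subsetD[rotated])
  then obtain x0 where x0: "x0 \<in> X" "block x0 0 (length s) = s" "y0 = \<phi> x0"
    unfolding U_def by blast
  have "openin (shift_top B Y) (shift_top B Y interior_of (\<phi> ` U))"
    by (rule openin_interior_of)
  then obtain M where "Y \<inter> central_cylinder M y0 \<subseteq> shift_top B Y interior_of (\<phi> ` U)"
    using y0 unfolding openin_shift_top_iff[OF Y] by meson
  with int_sub have M: "Y \<inter> central_cylinder M y0 \<subseteq> \<phi> ` U" by (rule order_trans[rotated])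
  \<comment> \<open>The block of \<open>x0\<close> from \<open>- k\<close> to \<open>k\<close> contains \<open>s\<close> at coordinate \<open>0\<close>, that is, at offset \<open>k\<close>, and
    determines the image from \<open>- M\<close> to \<open>M\<close>.\<close>
  define k where "k = M + m + length s"
  define a where "a = block x0 (- int k) (2 * k + 1)"
  have len: "length a = 2 * k + 1" by (simp add: a_def)
  show thesis
  proof (rule that, unfold marker_word_def, intro conjI ballI allI impI)
    show "a \<in> language X" using x0(1) by (auto simp: a_def)
    show "k + length s \<le> length a" unfolding len by (simp add: k_def)
    fix x y p
    assume x: "x \<in> X" and y: "y \<in> Y"
    assume "block x p (length a) = a \<and> block (\<phi> x) p (length a) = block y p (length a)"
    then have xa: "block x p (2 * k + 1) = block x0 (- int k) (2 * k + 1)"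
      and ya: "block (\<phi> x) p (2 * k + 1) = block y p (2 * k + 1)"
      unfolding len by (simp_all add: a_def)
    have \<phi>y: "\<phi> x (p + int k + j) = y (p + int k + j)" if "\<bar>j\<bar> \<le> int k" for j
      using ya[unfolded block_eq_block_iff, rule_format, of "int k + j"] that
      by (auto simp: add.assoc abs_le_iff)
    have xx0: "x (p + int k + j) = x0 j" if "\<bar>j\<bar> \<le> int k" for j
      using xa[unfolded block_eq_block_iff, rule_format, of "int k + j"] that
      by (auto simp: add.assoc abs_le_iff)
    have "block x (p + int k) (length s) = block x0 0 (length s)"
      unfolding block_eq_block_iff using xx0 by (simp add: k_def)
    then have xs: "block x (p + int k) (length s) = s" using x0(2) by simp
    define c where "c = p + int k"
    have "y (j + c) = y0 j" if j: "\<bar>j\<bar> \<le> int M" for j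
    proof -
      have "y (j + c) = \<phi> x (j + c)"
        using \<phi>y[of j] j by (simp add: c_def k_def algebra_simps)
      also have "\<dots> = \<phi> (\<lambda>i. x (i + c)) j"
        using code_translate[OF X \<phi> x, of c] by simp
      also have "\<dots> = \<phi> x0 j"
      proof (rule window_radiusD[OF window x0(1) translate_mem[OF X x]])
        fix i assume "\<bar>i - j\<bar> \<le> int m"
        then have "\<bar>i\<bar> \<le> int k" using j by (simp add: k_def)
        then show "x (i + c) = x0 i" using xx0[of i] by (simp add: c_def algebra_simps)
      qed
      finally show ?thesis using x0(3) by simp
    qed
    then have "(\<lambda>j. y (j + c)) \<in> central_cylinder M y0" by (rule central_cylinderI)
    then have "(\<lambda>j. y (j + c)) \<in> \<phi> ` U" using M translate_mem[OF Y y] by blast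
    then obtain u where u: "u \<in> X" "block u 0 (length s) = s" "\<phi> u = (\<lambda>j. y (j + c))"
      unfolding U_def by force
    let ?z = "\<lambda>i. u (i + - c)"
    have "?z \<in> X" using u(1) by (rule translate_mem[OF X])
    moreover have "\<phi> ?z = y" using code_translate[OF X \<phi> u(1), of "- c"] u(3) by simp
    moreover have "block ?z c (length s) = block u 0 (length s)"
      by (simp add: block_eq_block_iff)
    ultimately show "\<exists>z\<in>X. \<phi> z = y \<and> block z (p + int k) (length s) = s"
      using u(2) unfolding c_def by metis
    show "block x (p + int k) (length s) = s" by (fact xs)
  qed
qed

lemma left_transitive_obtain:
  assumes "left_transitive X x" "a \<in> language X"
  obtains p where "p < N" "block x p (length a) = a"
proof -
  let ?P = "{i. i < 0 \<and> block x i (length a) = a}"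
  have "infinite ?P" using assms unfolding left_transitive_def by blast
  then have "\<not> ?P \<subseteq> {N..<0}" using finite_subset by blast
  then show thesis using that by force
qed

lemma right_transitive_obtain:
  assumes "right_transitive X x" "a \<in> language X"
  obtains p where "N < p" "block x p (length a) = a"
proof -
  let ?P = "{i. i > 0 \<and> block x i (length a) = a}"
  have "infinite ?P" using assms unfolding right_transitive_def by blast
  then have "\<not> ?P \<subseteq> {0<..N}" using finite_subset by blast
  then show thesis using that by force
qed

theorem theorem4p16:
  fixes A :: "'a set" and B :: "'b set"
    and X :: "(int \<Rightarrow> 'a) set" and Y :: "(int \<Rightarrow> 'b) set"
    and \<phi> :: "(int \<Rightarrow> 'a) \<Rightarrow> int \<Rightarrow> 'b"
  assumes "synchronized_system A X"
    and "shift_space B Y"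
    and "sliding_block_code A X B Y \<phi>"
    and "semi_open_map (shift_top A X) (shift_top B Y) \<phi>"
  shows "bi_continuing_ae X Y \<phi>"
proof -
  note Y = assms(2) and \<phi> = assms(3)
  have X: "shift_space A X" using assms(1) unfolding synchronized_system_def by blast
  obtain v where v: "synchronizing_word X v"
    using assms(1) unfolding synchronized_system_def by blast
  obtain m where window: "window_radius X \<phi> m"
    using window_radius_exists[OF X Y \<phi>] .
  obtain s where s: "synchronizing_word X s" and long: "2 * m \<le> length s"
    using long_synchronizing_word_exists[OF X v] .
  have "s \<in> language X" using s unfolding synchronizing_word_def by blast
  then obtain a k where marker: "marker_word X Y \<phi> s a k"
    using marker_word_exists[OF X Y \<phi> assms(4)] by blast
  then have a: "a \<in> language X" and ka: "k + length s \<le> length a"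
    unfolding marker_word_def by blast+
  have "\<exists>x'\<in>X. left_asymptotic x' x \<and> \<phi> x' = y"
    if x: "x \<in> X" and y: "y \<in> Y" and trans: "left_transitive X x"
      and asym: "left_asymptotic (\<phi> x) y" for x y
  proof -
    obtain N where N: "\<And>i. i \<le> N \<Longrightarrow> \<phi> x i = y i"
      using asym unfolding left_asymptotic_def by blast
    obtain p where p: "p < N - int (length a)" and xa: "block x p (length a) = a"
      using left_transitive_obtain[OF trans a] .
    have "block (\<phi> x) p (length a) = block y p (length a)"
      unfolding block_eq_block_iff using N p by simp
    with marker x y xa obtain z where xs: "block x (p + int k) (length s) = s"
      and z: "z \<in> X" "\<phi> z = y" and zs: "block z (p + int k) (length s) = s"
      by (rule marker_wordE)
    let ?g = "\<lambda>j. if j < p + int k + int (length s) then x j else z j"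
    have g: "?g \<in> X" using splice_mem[OF X s x xs z(1) zs] .
    have "\<phi> ?g = y"
      by (rule splice_image[OF window long x z(1) g]) (use xs zs z(2) N p ka in auto)
    moreover have "left_asymptotic ?g x"
      unfolding left_asymptotic_def by (rule exI[of _ "p - 1"]) simp
    ultimately show ?thesis using g by blast
  qed
  moreover have "\<exists>x'\<in>X. right_asymptotic x' x \<and> \<phi> x' = y"
    if x: "x \<in> X" and y: "y \<in> Y" and trans: "right_transitive X x"
      and asym: "right_asymptotic (\<phi> x) y" for x y
  proof -
    obtain N where N: "\<And>i. N \<le> i \<Longrightarrow> \<phi> x i = y i"
      using asym unfolding right_asymptotic_def by blast
    obtain p where p: "N < p" and xa: "block x p (length a) = a"
      using right_transitive_obtain[OF trans a] .
    have "block (\<phi> x) p (length a) = block y p (length a)"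
      unfolding block_eq_block_iff using N p by simp
    with marker x y xa obtain z where xs: "block x (p + int k) (length s) = s"
      and z: "z \<in> X" "\<phi> z = y" and zs: "block z (p + int k) (length s) = s"
      by (rule marker_wordE)
    let ?g = "\<lambda>j. if j < p + int k + int (length s) then z j else x j"
    have g: "?g \<in> X" using splice_mem[OF X s z(1) zs x xs] .
    have "\<phi> ?g = y"
      by (rule splice_image[OF window long z(1) x g]) (use xs zs z(2) N p in auto)
    moreover have "right_asymptotic ?g x"
      unfolding right_asymptotic_def by (rule exI[of _ "p + int k + int (length s)"]) simp
    ultimately show ?thesis using g by blast
  qed
  ultimately show ?thesis
    unfolding bi_continuing_ae_def right_continuing_ae_def left_continuing_ae_def by blast
qed

end
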